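(* If the wild numbers conjecture is true (i.e. the wild integer semigroup $\mathcal{W}(\mathbb{Z})$ consists of all positive integers not divisible by $3$, equivalently the wild numbers are exactly the primes other than $3$), then the weak $3x+1$ conjecture holds, i.e. the semigroup $\mathcal{W}^{-1}$ contains every positive integer.
   Context: For integers $n\ge 0$ let $g(n)=\frac{3n+2}{2n+1}$. The wild semigroup $\mathcal{W}$ is the multiplicative semigroup of positive rationals generated by $\{g(n): n\ge 0\}$ together with $\frac12$ (all finite products, repetitions allowed). The wild integer semigroup is $\mathcal{W}(\mathbb{Z})=\mathcal{W}\cap\mathbb{Z}$; the wild numbers are its irreducible elements (elements not expressible as a product of two nonunits of $\mathcal{W}(\mathbb{Z})$). $\mathcal{W}^{-1}=\{w^{-1}: w\in\mathcal{W}\}$ is the semigroup generated by $\{\frac{2n+1}{3n+2}: n\ge 0\}$ together with $2$. *)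

theory Defs
  imports Complex_Main "HOL-Computational_Algebra.Primes"
begin

inductive_set semigroup_generated :: "'a::semigroup_mult set \<Rightarrow> 'a set" for S where
  gen: "x \<in> S \<Longrightarrow> x \<in> semigroup_generated S"
| mult: "x \<in> semigroup_generated S \<Longrightarrow> y \<in> semigroup_generated S \<Longrightarrow> x * y \<in> semigroup_generated S"

definition wild_gen :: "nat \<Rightarrow> rat" where
  "wild_gen n = of_nat (3 * n + 2) / of_nat (2 * n + 1)"

definition wild_semigroup :: "rat set" where
  "wild_semigroup = semigroup_generated (range wild_gen \<union> {1 / 2})"

definition wild_integer_semigroup :: "rat set" where
  "wild_integer_semigroup = wild_semigroup \<inter> \<int>"

definition wild_unit :: "rat \<Rightarrow> bool" where
  "wild_unit u \<longleftrightarrow> u \<in> wild_integer_semigroup \<and> (\<exists>v\<in>wild_integer_semigroup. u * v = 1)"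

text \<open>As usual for irreducible elements, units are excluded
  (\<open>1 = 1/2 * wild_gen 0\<close> does belong to the wild integer semigroup).\<close>

definition wild_numbers :: "rat set" where
  "wild_numbers = {w \<in> wild_integer_semigroup. \<not> wild_unit w \<and>
     (\<forall>a\<in>wild_integer_semigroup. \<forall>b\<in>wild_integer_semigroup.
        w = a * b \<longrightarrow> wild_unit a \<or> wild_unit b)}"

definition inverse_wild_semigroup :: "rat set" where
  "inverse_wild_semigroup = inverse ` wild_semigroup"

definition wild_numbers_conjecture :: bool where
  "wild_numbers_conjecture \<longleftrightarrow>
     wild_integer_semigroup = {of_nat n |n. 0 < n \<and> \<not> 3 dvd n}"

definition weak_3x1_conjecture :: bool where
  "weak_3x1_conjecture \<longleftrightarrow> (\<forall>n::nat. 0 < n \<longrightarrow> of_nat n \<in> inverse_wild_semigroup)"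

lemma inverse_semigroup_generated:
  fixes S :: "'a::field set"
  shows "inverse ` semigroup_generated S = semigroup_generated (inverse ` S)"
proof
  have "inverse x \<in> semigroup_generated (inverse ` S)" if "x \<in> semigroup_generated S" for x
    using that by induction (auto intro: semigroup_generated.intros)
  then show "inverse ` semigroup_generated S \<subseteq> semigroup_generated (inverse ` S)" by blast
next
  have "inverse x \<in> semigroup_generated S" if "x \<in> semigroup_generated (inverse ` S)" for x
    using that by induction (auto intro: semigroup_generated.intros)
  then show "semigroup_generated (inverse ` S) \<subseteq> inverse ` semigroup_generated S"
    by (metis imageI inverse_inverse_eq subsetI)
qed

lemma inverse_wild_semigroup_eq:
  "inverse_wild_semigroup =
     semigroup_generated (range (\<lambda>n. of_nat (2 * n + 1) / of_nat (3 * n + 2)) \<union> {2})"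
  unfolding inverse_wild_semigroup_def wild_semigroup_def inverse_semigroup_generated
  by (simp add: image_Un image_image wild_gen_def)

end

theory Submission
  imports Defs "HOL-Number_Theory.Residues"
begin

text \<open>
  Write \<open>S\<close> for the inverse wild semigroup. An odd \<open>n\<close> lies in \<open>S\<close> as soon as \<open>(3 * n + 1) / 2\<close> does,
  and under the conjecture \<open>1 / k \<in> S\<close> for every \<open>k\<close> prime to 3, so that \<open>d * k \<in> S\<close> gives \<open>d \<in> S\<close>.
  A prime \<open>d \<noteq> 2\<close> with \<open>d \<equiv> 2\<close> modulo 3 is therefore in \<open>S\<close>: by Fermat \<open>2 ^ (d - 1) = 3 * d * k + 1\<close>,
  where \<open>k\<close> is prime to 3 because \<open>2 ^ (d - 1) \<equiv> 7\<close> modulo 9.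
  All other integers follow by strong induction. For an odd prime \<open>n\<close>, the number
  \<open>d = (3 * n + 1) / 2\<close> is congruent to 2 modulo 3 and less than \<open>2 * n\<close>, so it is either a prime
  of the kind just treated or a product of two factors smaller than \<open>n\<close>.
\<close>

section \<open>Fractions and integers in the wild semigroup\<close>

lemma one_in_wild_semigroup: "1 \<in> wild_semigroup"
proof -
  have "wild_gen 0 * (1 / 2) \<in> wild_semigroup"
    unfolding wild_semigroup_def
    by (intro semigroup_generated.mult semigroup_generated.gen) auto
  then show ?thesis
    by (simp add: wild_gen_def)
qed

lemma wild_integer_semigroup_mult:
  "x \<in> wild_integer_semigroup \<Longrightarrow> y \<in> wild_integer_semigroup \<Longrightarrow> x * y \<in> wild_integer_semigroup"
  unfolding wild_integer_semigroup_def wild_semigroup_def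
  by (auto intro: semigroup_generated.mult)

text \<open>The generators have numerators \<open>3 * n + 2\<close> and 1, and since 3 is prime,
  products keep the numerator prime to 3. The fraction need not be reduced.\<close>

lemma wild_semigroup_imp_fraction:
  assumes "x \<in> wild_semigroup"
  shows "\<exists>a b :: nat. 0 < a \<and> 0 < b \<and> \<not> 3 dvd a \<and> x = of_nat a / of_nat b"
  using assms unfolding wild_semigroup_def
proof induction
  case (gen x)
  then consider n where "x = wild_gen n" | "x = 1 / 2"
    by auto
  then show ?case
  proof cases
    case 1
    have "\<not> 3 dvd 3 * n + 2"
      by presburger
    with 1 show ?thesis
      by (intro exI[of _ "3 * n + 2"] exI[of _ "2 * n + 1"]) (simp add: wild_gen_def)
  next
    case 2
    then show ?thesis
      by (intro exI[of _ 1] exI[of _ 2]) simp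
  qed
next
  case (mult x y)
  then obtain a b c d :: nat where
    "0 < a" "0 < b" "\<not> 3 dvd a" "x = of_nat a / of_nat b"
    "0 < c" "0 < d" "\<not> 3 dvd c" "y = of_nat c / of_nat d"
    by blast
  moreover from this have "\<not> 3 dvd a * c"
    by (simp add: prime_dvd_mult_iff)
  ultimately show ?case
    by (intro exI[of _ "a * c"] exI[of _ "b * d"]) simp
qed

text \<open>This inclusion of the conjecture holds unconditionally: if an integer \<open>z\<close>
  equals \<open>a / b\<close>, then \<open>z\<close> divides the numerator \<open>a\<close>, which
  is prime to 3.\<close>

lemma wild_integer_semigroup_subset:
  "wild_integer_semigroup \<subseteq> {of_nat n |n. 0 < n \<and> \<not> 3 dvd n}"
proof
  fix x assume x: "x \<in> wild_integer_semigroup"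
  then obtain a b :: nat where ab: "0 < a" "0 < b" "\<not> 3 dvd a" "x = of_nat a / of_nat b"
    using wild_semigroup_imp_fraction unfolding wild_integer_semigroup_def by blast
  have "0 < x"
    using ab by simp
  moreover from x obtain z where "x = of_int z"
    unfolding wild_integer_semigroup_def by (auto elim: Ints_cases)
  ultimately have n: "x = of_nat (nat z)" "0 < nat z"
    by simp_all
  have "of_nat (nat z * b) = (of_nat a :: rat)"
    using ab n by (simp add: field_simps)
  then have "nat z * b = a"
    using of_nat_eq_iff by blast
  then have "\<not> 3 dvd nat z"
    using ab(3) by auto
  with n show "x \<in> {of_nat n |n. 0 < n \<and> \<not> 3 dvd n}"
    by blast
qed

section \<open>Wild numbers and primes\<close>

text \<open>The positive integers prime to 3 have 1 as their only unit and contain all divisors of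
  their elements, so irreducibility there agrees with primality among the natural numbers.\<close>

lemma wild_numbers_if_conjecture:
  assumes wild_numbers_conjecture
  shows "wild_numbers = {of_nat p |p. prime p \<and> p \<noteq> 3}"
proof -
  have W: "wild_integer_semigroup = {of_nat n |n. 0 < n \<and> \<not> 3 dvd n}"
    using assms by (simp add: wild_numbers_conjecture_def)
  have mem: "of_nat n \<in> wild_integer_semigroup \<longleftrightarrow> 0 < n \<and> \<not> 3 dvd n" for n
    unfolding W by auto
  have unit: "wild_unit (of_nat n) \<longleftrightarrow> n = 1" for n
  proof
    assume "wild_unit (of_nat n)"
    then obtain m where "of_nat n * of_nat m = (1 :: rat)"
      unfolding wild_unit_def W by auto
    then have "of_nat (n * m) = (of_nat 1 :: rat)"
      by simp
    then have "n * m = 1"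
      using of_nat_eq_iff by blast
    then show "n = 1"
      by simp
  next
    assume "n = 1"
    then show "wild_unit (of_nat n)"
      unfolding wild_unit_def using mem[of 1] by force
  qed
  have char: "of_nat n \<in> wild_numbers \<longleftrightarrow>
      0 < n \<and> \<not> 3 dvd n \<and> n \<noteq> 1 \<and> (\<forall>a b. n = a * b \<longrightarrow> a = 1 \<or> b = 1)" (is "_ \<longleftrightarrow> ?R") for n
  proof
    assume n: "of_nat n \<in> wild_numbers"
    then have "of_nat n \<in> wild_integer_semigroup" "\<not> wild_unit (of_nat n)"
      by (simp_all add: wild_numbers_def)
    then have n': "0 < n" "\<not> 3 dvd n" "n \<noteq> 1"
      by (simp_all add: mem unit del: One_nat_def)
    moreover have "a = 1 \<or> b = 1" if ab: "n = a * b" for a b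
    proof -
      have "of_nat a \<in> wild_integer_semigroup" "of_nat b \<in> wild_integer_semigroup"
        using n' ab by (auto simp: mem)
      moreover have "(of_nat n :: rat) = of_nat a * of_nat b"
        using ab by simp
      ultimately have "wild_unit (of_nat a) \<or> wild_unit (of_nat b)"
        using n unfolding wild_numbers_def by blast
      then show ?thesis
        by (simp only: unit)
    qed
    ultimately show ?R
      by blast
  next
    assume R: ?R
    have "wild_unit a \<or> wild_unit b"
      if "a \<in> wild_integer_semigroup" "b \<in> wild_integer_semigroup" "of_nat n = a * b" for a b
    proof -
      from that obtain i j where ij: "a = of_nat i" "b = of_nat j"
        unfolding W by auto
      with that(3) have "of_nat n = (of_nat (i * j) :: rat)"
        by simp
      then have "n = i * j"
        using of_nat_eq_iff by blast
      with R have "i = 1 \<or> j = 1"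
        by blast
      then show ?thesis
        by (simp only: ij unit)
    qed
    moreover have "of_nat n \<in> wild_integer_semigroup" "\<not> wild_unit (of_nat n)"
      using R by (simp_all add: mem unit)
    ultimately show "of_nat n \<in> wild_numbers"
      unfolding wild_numbers_def by blast
  qed
  have prime: "of_nat n \<in> wild_numbers \<longleftrightarrow> prime n \<and> n \<noteq> 3" for n
  proof
    assume "of_nat n \<in> wild_numbers"
    then have n: "0 < n" "\<not> 3 dvd n" "n \<noteq> 1" "\<And>a b. n = a * b \<Longrightarrow> a = 1 \<or> b = 1"
      unfolding char by blast+
    have "m = 1 \<or> m = n" if "m dvd n" for m
      using that n(4) by (metis dvdE mult.right_neutral)
    then show "prime n \<and> n \<noteq> 3"
      using n unfolding prime_nat_iff by fastforce
  next
    assume n: "prime n \<and> n \<noteq> 3"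
    then have "\<not> 3 dvd n"
      using primes_dvd_imp_eq[of 3 n] by auto
    moreover have "0 < n" "n \<noteq> 1"
      using n prime_gt_0_nat by auto
    ultimately show "of_nat n \<in> wild_numbers"
      unfolding char using n prime_product by blast
  qed
  have "wild_numbers \<subseteq> range of_nat"
    unfolding wild_numbers_def W by auto
  then show ?thesis
    using prime by blast
qed

text \<open>An integer prime to 3 is a product of primes other than 3, each of them wild, so
  induction on the prime factors gives the inclusion that is not automatic.\<close>

lemma conjecture_if_wild_numbers:
  assumes "wild_numbers = {of_nat p |p. prime p \<and> p \<noteq> 3}"
  shows wild_numbers_conjecture
proof -
  have "of_nat n \<in> wild_integer_semigroup" if "0 < n" "\<not> 3 dvd n" for n
    using that
  proof (induction n rule: prime_divisors_induct)
    case zero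
    then show ?case by simp
  next
    case (unit n)
    then show ?case
      using one_in_wild_semigroup by (simp add: wild_integer_semigroup_def)
  next
    case (factor p n)
    have "of_nat p \<in> wild_numbers"
      using factor unfolding assms by auto
    then have "of_nat p \<in> wild_integer_semigroup"
      by (simp add: wild_numbers_def)
    moreover have "of_nat n \<in> wild_integer_semigroup"
      using factor by (simp add: prime_dvd_mult_iff)
    ultimately show ?case
      using wild_integer_semigroup_mult by simp
  qed
  then show ?thesis
    using wild_integer_semigroup_subset unfolding wild_numbers_conjecture_def by blast
qed

section \<open>Closure properties of the inverse wild semigroup\<close>

lemma inverse_wild_semigroup_mult:
  "x \<in> inverse_wild_semigroup \<Longrightarrow> y \<in> inverse_wild_semigroup \<Longrightarrow> x * y \<in> inverse_wild_semigroup"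
  unfolding inverse_wild_semigroup_eq by (rule semigroup_generated.mult)

lemma two_in_inverse_wild_semigroup: "2 \<in> inverse_wild_semigroup"
  unfolding inverse_wild_semigroup_eq by (rule semigroup_generated.gen) simp

lemma power_two_in_inverse_wild_semigroup: "2 ^ n \<in> inverse_wild_semigroup"
proof (induction n)
  case 0
  show ?case
    using one_in_wild_semigroup unfolding inverse_wild_semigroup_def by force
next
  case (Suc n)
  then show ?case
    by (simp add: inverse_wild_semigroup_mult two_in_inverse_wild_semigroup)
qed

text \<open>For \<open>n = 2 * i + 1\<close> the Collatz successor \<open>(3 * n + 1) / 2\<close> is
  \<open>3 * i + 2\<close>; the generator with index \<open>i\<close> undoes this step.\<close>

lemma inverse_wild_semigroup_Collatz_step:
  assumes "of_nat (3 * i + 2) \<in> inverse_wild_semigroup"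
  shows "of_nat (2 * i + 1) \<in> inverse_wild_semigroup"
proof -
  have "of_nat (2 * i + 1) / of_nat (3 * i + 2) \<in> inverse_wild_semigroup"
    unfolding inverse_wild_semigroup_eq by (rule semigroup_generated.gen) simp
  from inverse_wild_semigroup_mult[OF this assms] show ?thesis
    by (simp del: of_nat_add of_nat_mult)
qed

text \<open>The conjecture makes \<open>k\<close> wild, so \<open>1 / k\<close> is available as a
  factor. Only here does the proof of the weak conjecture draw on the content of the
  assumption.\<close>

lemma inverse_wild_semigroup_cancel:
  assumes wild_numbers_conjecture "0 < k" "\<not> 3 dvd k"
    and "of_nat (d * k) \<in> inverse_wild_semigroup"
  shows "of_nat d \<in> inverse_wild_semigroup"
proof -
  have "of_nat k \<in> wild_integer_semigroup"
    using assms(1-3) unfolding wild_numbers_conjecture_def by auto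
  then have "inverse (of_nat k) \<in> inverse_wild_semigroup"
    unfolding wild_integer_semigroup_def inverse_wild_semigroup_def by blast
  from inverse_wild_semigroup_mult[OF assms(4) this] show ?thesis
    using assms(2) by (simp add: field_simps)
qed

section \<open>Primes congruent to 2 modulo 3\<close>

lemma prime_2_mod_3_in_inverse_wild_semigroup:
  assumes wild_numbers_conjecture "prime d" "d \<noteq> 2" "d mod 3 = (2 :: nat)"
  shows "of_nat d \<in> inverse_wild_semigroup"
proof -
  have "odd d"
    using assms primes_dvd_imp_eq[of 2 d] by auto
  then have "d = 6 * (d div 6) + 5"
    using assms(4) by presburger
  then obtain t where t: "d = 6 * t + 5" ..
  have "[2 ^ (d - 1) = 1] (mod d)"
    using assms(2) \<open>odd d\<close> assms(3) primes_dvd_imp_eq[of d 2] by (intro fermat_theorem) auto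
  then have d_dvd: "d dvd 2 ^ (d - 1) - 1"
    by (simp add: cong_altdef_nat)
  \<comment> \<open>The exponent \<open>d - 1\<close> is \<open>6 * t + 4\<close>, and 64 is 1
    modulo 9. Hence \<open>2 ^ (d - 1) - 1\<close> is 6 modulo 9 and contains the factor 3 exactly
    once.\<close>
  have "[16 * (64 :: nat) ^ t = 7 * 1 ^ t] (mod 9)"
    by (intro cong_mult cong_pow) (simp_all add: cong_def)
  then have mod9: "(2 :: nat) ^ (d - 1) mod 9 = 7"
    by (simp add: t power_add power_mult cong_def)
  then have "3 dvd (2 :: nat) ^ (d - 1) - 1" and not9: "\<not> 9 dvd (2 :: nat) ^ (d - 1) - 1"
    by presburger+
  moreover have "coprime 3 d"
    using assms(4) by (intro prime_imp_coprime) auto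
  ultimately obtain k where k: "2 ^ (d - 1) - 1 = 3 * d * k"
    using d_dvd by (metis divides_mult dvdE)
  have "\<not> 3 dvd k"
  proof
    assume "3 dvd k"
    then have "3 * 3 dvd 3 * d * k"
      by (simp add: mult.assoc)
    then show False
      using not9 k by simp
  qed
  then have "0 < k"
    by (intro gr0I) simp
  have "d - 1 = Suc (d - 2)"
    using t by simp
  then have "2 * 2 ^ (d - 2) = (2 :: nat) ^ (d - 1)"
    by (simp only: power_Suc)
  also have "\<dots> = 2 ^ (d - 1) - 1 + 1"
    by simp
  \<comment> \<open>With \<open>d * k = 2 * i + 1\<close> the right-hand side becomes
    \<open>2 * (3 * i + 2)\<close>, so the Collatz successor of \<open>d * k\<close> is the power
    \<open>2 ^ (d - 2)\<close>.\<close>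
  finally have pow: "2 * 2 ^ (d - 2) = 3 * (d * k) + 1"
    unfolding k by (simp only: mult.assoc)
  then have "odd (d * k)"
    by presburger
  then obtain i where i: "d * k = 2 * i + 1"
    by (rule oddE)
  then have "3 * i + 2 = 2 ^ (d - 2)"
    using pow by simp
  then have "of_nat (3 * i + 2) \<in> inverse_wild_semigroup"
    using power_two_in_inverse_wild_semigroup by (metis of_nat_numeral of_nat_power)
  then have "of_nat (d * k) \<in> inverse_wild_semigroup"
    unfolding i by (rule inverse_wild_semigroup_Collatz_step)
  then show ?thesis
    using inverse_wild_semigroup_cancel assms(1) \<open>0 < k\<close> \<open>\<not> 3 dvd k\<close> by blast
qed

section \<open>Strong induction over the positive integers\<close>

lemma composite_natE:
  assumes "1 < (n :: nat)" "\<not> prime n"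
  obtains a b where "n = a * b" "1 < a" "1 < b"
  using assms by (metis One_nat_def Suc_lessI dvdE gr0I less_nat_zero_code mult.right_neutral
      mult_0_right mult_is_0 prime_nat_iff)

lemma weak_3x1_if_conjecture:
  assumes wild_numbers_conjecture
  shows weak_3x1_conjecture
proof -
  have "of_nat n \<in> inverse_wild_semigroup" if "0 < n" for n
    using that
  proof (induction n rule: less_induct)
    case (less n)
    have prod: "of_nat (a * b) \<in> inverse_wild_semigroup" if "0 < a" "0 < b" "a < n" "b < n" for a b
      using that less.IH inverse_wild_semigroup_mult by simp
    consider "n = 1" | "n = 2" | "1 < n" "\<not> prime n" | "prime n" "odd n"
      using less.prems primes_dvd_imp_eq[of 2 n] by fastforce
    then show ?case
    proof cases
      case 1
      then show ?thesis
        using power_two_in_inverse_wild_semigroup[of 0] by simp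
    next
      case 2
      then show ?thesis
        using two_in_inverse_wild_semigroup by simp
    next
      case 3
      then obtain a b where "n = a * b" "1 < a" "1 < b"
        by (rule composite_natE)
      then show ?thesis
        using prod[of a b] by simp
    next
      case 4
      from \<open>odd n\<close> obtain i where i: "n = 2 * i + 1"
        by (rule oddE)
      have "0 < i"
        using \<open>prime n\<close> i by (intro gr0I) auto
      have "of_nat (3 * i + 2) \<in> inverse_wild_semigroup"
      \<comment> \<open>The successor exceeds \<open>n\<close>, so the induction hypothesis does not
        apply to it directly. If it is prime, \<open>0 < i\<close> rules out the exception
        2.\<close>
      proof (cases "prime (3 * i + 2)")
        case True
        have "(3 * i + 2) mod 3 = 2"
          by presburger
        with True show ?thesis
          using \<open>0 < i\<close> assms by (intro prime_2_mod_3_in_inverse_wild_semigroup) auto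
      next
        case False
        then obtain a b where ab: "3 * i + 2 = a * b" "1 < a" "1 < b"
          using composite_natE[of "3 * i + 2"] by auto
        \<comment> \<open>Each factor is at most \<open>(3 * i + 2) / 2\<close>, which is below
          \<open>2 * i + 1\<close> exactly because \<open>0 < i\<close>.\<close>
        have "2 * a \<le> a * b" "2 * b \<le> a * b"
          using ab by simp_all
        then have "a < n" "b < n"
          using ab(1) i \<open>0 < i\<close> by linarith+
        then show ?thesis
          unfolding ab(1) using ab by (intro prod) auto
      qed
      then show ?thesis
        unfolding i by (rule inverse_wild_semigroup_Collatz_step)
    qed
  qed
  then show ?thesis
    by (simp add: weak_3x1_conjecture_def)
qed

theorem theorem3p4:
  "(wild_numbers_conjecture \<longleftrightarrow> wild_numbers = {of_nat p |p. prime p \<and> p \<noteq> 3}) \<and>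
   (wild_numbers_conjecture \<longrightarrow> weak_3x1_conjecture)"
  using wild_numbers_if_conjecture conjecture_if_wild_numbers weak_3x1_if_conjecture by blast

end
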